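(* Let $I=[0,1]$, and let $\mathcal{M}_0$ be the collection of all subsets $A\subset I$ such that $$\mu^*(A\cap X)+\mu^*(A^c\cap X)=\mu^*(X)\quad\text{for every subset } X\subset I ,$$ where $A^c=I\setminus A$ and $\mu^*$ is Lebesgue outer measure. Then $\mathcal{M}_0$, which is a $\sigma$-algebra of subsets of $I$, equals $\mathcal{M}(I)$, the $\sigma$-algebra of subsets of $I$ generated by Borel sets and null sets.
   Context: For a bounded set $A\subset\mathbb{R}$, the Lebesgue outer measure is $\mu^*(A)=\inf\sum_{n=1}^\infty\mathrm{len}(U_n)$, the infimum taken over all countable coverings $\{U_n\}$ of $A$ by open intervals, where $\mathrm{len}((a,b))=b-a$. A set $X\subset\mathbb{R}$ is a null set if for every $\epsilon>0$ there is a sequence of open intervals $\{U_n\}_{n=1}^\infty$ with $X\subset\bigcup_n U_n$ and $\sum_n\mathrm{len}(U_n)<\epsilon$. $\mathcal{M}$ is the $\sigma$-algebra of subsets of $\mathbb{R}$ generated by open intervals and null sets (equivalently, by Borel sets and null sets), and $\mathcal{M}(I)$ is the collection of subsets of $I$ belonging to $\mathcal{M}$. *)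

theory Defs
  imports "HOL-Analysis.Analysis"
begin

text \<open>
  The interval with endpoints \<open>a n \<le> b n\<close> may be empty, so finite covers are
  included as well.
\<close>

definition interval_cover :: "(nat \<Rightarrow> real) \<Rightarrow> (nat \<Rightarrow> real) \<Rightarrow> real set \<Rightarrow> bool" where
  "interval_cover a b A \<longleftrightarrow> (\<forall>n. a n \<le> b n) \<and> A \<subseteq> (\<Union>n. {a n<..<b n})"

text \<open>
  Total lengths are taken in \<^typ>\<open>ennreal\<close>, so that covers whose lengths have a divergent
  sum contribute \<open>\<infinity>\<close>.  On bounded sets the infimum is finite.
\<close>

definition lebesgue_outer :: "real set \<Rightarrow> ennreal" where
  "lebesgue_outer A = (INF (a, b) \<in> {(a, b). interval_cover a b A}. \<Sum>n. ennreal (b n - a n))"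

definition is_null_set :: "real set \<Rightarrow> bool" where
  "is_null_set N \<longleftrightarrow>
     (\<forall>\<epsilon>::real. \<epsilon> > 0 \<longrightarrow> (\<exists>a b. interval_cover a b N \<and> (\<Sum>n. ennreal (b n - a n)) < ennreal \<epsilon>))"

definition measurable_sets :: "real set set" where
  "measurable_sets = sigma_sets UNIV ({{a<..<b} |a b. a \<le> b} \<union> {N. is_null_set N})"

definition measurable_subsets :: "real set \<Rightarrow> real set set" where
  "measurable_subsets S = {A. A \<subseteq> S \<and> A \<in> measurable_sets}"

definition caratheodory_sets :: "real set \<Rightarrow> real set set" where
  "caratheodory_sets S = lambda_system S (Pow S) lebesgue_outer"

lemma caratheodory_sets_iff:
  "A \<in> caratheodory_sets S \<longleftrightarrow>
     A \<subseteq> S \<and> (\<forall>X. X \<subseteq> S \<longrightarrow>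
       lebesgue_outer (A \<inter> X) + lebesgue_outer ((S - A) \<inter> X) = lebesgue_outer X)"
  by (auto simp: caratheodory_sets_def lambda_system_def)

end

theory Submission imports Defs begin

text \<open>
  Write \<open>\<mu>\<close> for the outer measure and \<open>S\<close> for the interval.

  Splitting every interval of a cover at a point \<open>c\<close> does not change its total length, so
  half-lines satisfy Caratheodory's condition (\<open>half_line_caratheodory\<close>).  Null sets satisfy
  it by monotonicity.  By Caratheodory's lemma the sets that satisfy it form a
  \<open>\<sigma>\<close>-algebra, so this \<open>\<sigma>\<close>-algebra contains all Borel and all null subsets of \<open>S\<close>.

  Conversely, every set \<open>A\<close> lies in a Borel set \<open>B\<close> with \<open>\<mu> B = \<mu> A\<close>, namely
  an intersection of countably many covers (\<open>borel_hull\<close>).  If \<open>A\<close> satisfies Caratheodory's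
  condition, then testing it on \<open>B \<inter> S\<close> gives \<open>\<mu> A + \<mu> (B \<inter> S - A) = \<mu> A\<close>.
  As \<open>\<mu> A\<close> is finite, \<open>B \<inter> S - A\<close> is a null set.  Hence \<open>A\<close> is the difference of a
  Borel set and a null set (\<open>caratheodory_subset_measurable\<close>).

  The third \<open>\<sigma>\<close>-algebra lies between the other two: a measurable subset of \<open>S\<close> is
  generated by the traces on \<open>S\<close> of intervals and null sets
  (\<open>measurable_subsets_generated\<close>).  So the three inclusions form a cycle.
\<close>

section \<open>Outer measure\<close>

lemma lebesgue_outer_le_cover:
  assumes "interval_cover a b A"
  shows "lebesgue_outer A \<le> (\<Sum>n. ennreal (b n - a n))"
  unfolding lebesgue_outer_def using assms
  by (intro INF_lower2[of "(a, b)"]) auto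

lemma lebesgue_outer_less_cover:
  assumes "lebesgue_outer A < t"
  obtains a b where "interval_cover a b A" "(\<Sum>n. ennreal (b n - a n)) < t"
  using assms unfolding lebesgue_outer_def INF_less_iff by auto

lemma lebesgue_outer_mono:
  assumes "A \<subseteq> B"
  shows "lebesgue_outer A \<le> lebesgue_outer B"
  unfolding lebesgue_outer_def using assms
  by (intro INF_superset_mono) (auto simp: interval_cover_def)

lemma lebesgue_outer_le_length:
  assumes "A \<subseteq> {a<..<b}" "a \<le> b"
  shows "lebesgue_outer A \<le> ennreal (b - a)"
proof -
  define b' where "b' n = (if n = 0 then b else a)" for n :: nat
  have "interval_cover (\<lambda>n. a) b' A"
    using assms by (auto simp: interval_cover_def b'_def)
  then have "lebesgue_outer A \<le> (\<Sum>n. ennreal (b' n - a))"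
    by (rule lebesgue_outer_le_cover)
  also have "\<dots> = (\<Sum>n\<in>{0}. ennreal (b' n - a))"
    by (rule suminf_finite) (auto simp: b'_def)
  finally show ?thesis by (simp add: b'_def)
qed

lemma is_null_set_iff: "is_null_set N \<longleftrightarrow> lebesgue_outer N = 0"
proof
  assume null: "is_null_set N"
  have "lebesgue_outer N \<le> 0"
  proof (rule ennreal_le_epsilon)
    fix e :: real assume "0 < e"
    with null obtain a b where
      "interval_cover a b N" "(\<Sum>n. ennreal (b n - a n)) < ennreal e"
      unfolding is_null_set_def by blast
    then show "lebesgue_outer N \<le> 0 + ennreal e"
      using lebesgue_outer_le_cover[of a b N] by simp
  qed
  then show "lebesgue_outer N = 0" by simp
next
  assume "lebesgue_outer N = 0"
  then show "is_null_set N"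
    unfolding is_null_set_def by (metis ennreal_less_zero_iff lebesgue_outer_less_cover)
qed

lemma lebesgue_outer_singleton: "lebesgue_outer {c} = 0"
proof -
  have "lebesgue_outer {c} \<le> 0"
  proof (rule ennreal_le_epsilon)
    fix e :: real assume "0 < e"
    then show "lebesgue_outer {c} \<le> 0 + ennreal e"
      using lebesgue_outer_le_length[of "{c}" "c - e / 2" "c + e / 2"] by simp
  qed
  then show ?thesis by simp
qed

lemma lebesgue_outer_empty: "lebesgue_outer {} = 0"
  using lebesgue_outer_mono[of "{}" "{0}"] by (simp add: lebesgue_outer_singleton)

text \<open>
  Cover the \<open>m\<close>-th set with an excess of at most \<open>e / 2 ^ Suc m\<close> and enumerate all
  the intervals along the pairing of \<open>\<nat> \<times> \<nat>\<close> with \<open>\<nat>\<close>.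
\<close>

lemma lebesgue_outer_countably_subadditive:
  "lebesgue_outer (\<Union>m. A m) \<le> (\<Sum>m. lebesgue_outer (A m))"
proof (rule ennreal_le_epsilon)
  fix e :: real
  assume e: "0 < e" and fin: "(\<Sum>m. lebesgue_outer (A m)) < top"
  have "\<exists>a b. interval_cover a b (A m) \<and>
      (\<Sum>n. ennreal (b n - a n)) < lebesgue_outer (A m) + ennreal (e * (1 / 2) ^ Suc m)" for m
  proof -
    have "lebesgue_outer (A m) \<le> (\<Sum>m. lebesgue_outer (A m))"
      using sum_le_suminf[of "\<lambda>m. lebesgue_outer (A m)" "{m}"] by simp
    then have "lebesgue_outer (A m) < lebesgue_outer (A m) + ennreal (e * (1 / 2) ^ Suc m)"
      using fin e ennreal_add_left_cancel_less[of "lebesgue_outer (A m)" 0] by auto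
    then show ?thesis by (rule lebesgue_outer_less_cover) blast
  qed
  then obtain a b where cover: "\<And>m. interval_cover (a m) (b m) (A m)"
    and len: "\<And>m. (\<Sum>n. ennreal (b m n - a m n)) <
                lebesgue_outer (A m) + ennreal (e * (1 / 2) ^ Suc m)"
    by metis
  define a' where "a' = (\<lambda>i. case_prod a (prod_decode i))"
  define b' where "b' = (\<lambda>i. case_prod b (prod_decode i))"
  have "interval_cover a' b' (\<Union>m. A m)"
    unfolding interval_cover_def
  proof (intro conjI allI subsetI)
    show "a' n \<le> b' n" for n
      using cover by (auto simp: a'_def b'_def interval_cover_def split: prod.split)
  next
    fix x assume "x \<in> (\<Union>m. A m)"
    then obtain m n where "x \<in> {a m n<..<b m n}"
      using cover unfolding interval_cover_def by blast
    then have "x \<in> {a' (prod_encode (m, n))<..<b' (prod_encode (m, n))}"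
      by (simp add: a'_def b'_def)
    then show "x \<in> (\<Union>n. {a' n<..<b' n})" by blast
  qed
  then have "lebesgue_outer (\<Union>m. A m) \<le> (\<Sum>i. ennreal (b' i - a' i))"
    by (rule lebesgue_outer_le_cover)
  also have "\<dots> = (\<Sum>i. (\<lambda>(m, n). ennreal (b m n - a m n)) (prod_decode i))"
    by (simp add: a'_def b'_def split_beta)
  also have "\<dots> = (\<Sum>m. \<Sum>n. ennreal (b m n - a m n))"
    by (rule suminf_ennreal_2dimen) simp
  also have "\<dots> \<le> (\<Sum>m. lebesgue_outer (A m) + ennreal (e * (1 / 2) ^ Suc m))"
    using len by (intro suminf_le) (auto intro: less_imp_le)
  also have "\<dots> = (\<Sum>m. lebesgue_outer (A m)) + (\<Sum>m. ennreal (e * (1 / 2) ^ Suc m))"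
    by (rule suminf_add[symmetric]) auto
  also have "(\<Sum>m. ennreal (e * (1 / 2) ^ Suc m)) = ennreal e"
    using e sums_mult[OF power_half_series, of e] by (intro suminf_ennreal_eq) auto
  finally show "lebesgue_outer (\<Union>m. A m) \<le> (\<Sum>m. lebesgue_outer (A m)) + ennreal e" .
qed

lemma outer_measure_space_lebesgue_outer: "outer_measure_space (Pow S) lebesgue_outer"
  unfolding outer_measure_space_def positive_def increasing_def countably_subadditive_def
  by (auto simp: lebesgue_outer_empty lebesgue_outer_mono lebesgue_outer_countably_subadditive)

lemma lebesgue_outer_Un_le: "lebesgue_outer (A \<union> B) \<le> lebesgue_outer A + lebesgue_outer B"
proof -
  have "lebesgue_outer (A \<union> B) = lebesgue_outer (\<Union>n. binaryset A B n)"
    by (simp add: UN_binaryset_eq)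
  also have "\<dots> \<le> (\<Sum>n. lebesgue_outer (binaryset A B n))"
    by (rule lebesgue_outer_countably_subadditive)
  also have "\<dots> = lebesgue_outer A + lebesgue_outer B"
    by (intro suminf_binaryset_eq lebesgue_outer_empty)
  finally show ?thesis .
qed

section \<open>Measurable sets satisfy the condition of Caratheodory\<close>

lemma sigma_algebra_caratheodory: "sigma_algebra S (caratheodory_sets S)"
proof -
  interpret sigma_algebra S "Pow S" by (rule sigma_algebra_Pow)
  show ?thesis
    using caratheodory_lemma[OF outer_measure_space_lebesgue_outer]
    by (simp add: measure_space_def caratheodory_sets_def)
qed

text \<open>The other inequality of the condition is subadditivity.\<close>

lemma caratheodory_setsI:
  assumes "A \<subseteq> S"
    and "\<And>X. X \<subseteq> S \<Longrightarrow> lebesgue_outer (A \<inter> X) + lebesgue_outer (X - A) \<le> lebesgue_outer X"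
  shows "A \<in> caratheodory_sets S"
  unfolding caratheodory_sets_iff
proof (intro conjI allI impI)
  fix X assume X: "X \<subseteq> S"
  have "(S - A) \<inter> X = X - A" "(A \<inter> X) \<union> (X - A) = X" using X by auto
  then show "lebesgue_outer (A \<inter> X) + lebesgue_outer ((S - A) \<inter> X) = lebesgue_outer X"
    using assms(2)[OF X] lebesgue_outer_Un_le[of "A \<inter> X" "X - A"] by (simp add: antisym)
qed fact

lemma null_set_caratheodory:
  assumes "N \<subseteq> S" "is_null_set N"
  shows "N \<in> caratheodory_sets S"
proof (rule caratheodory_setsI)
  fix X
  have "lebesgue_outer (N \<inter> X) = 0"
    using assms lebesgue_outer_mono[of "N \<inter> X" N] by (simp add: is_null_set_iff)
  then show "lebesgue_outer (N \<inter> X) + lebesgue_outer (X - N) \<le> lebesgue_outer X"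
    by (simp add: lebesgue_outer_mono)
qed fact

text \<open>
  Each interval \<open>(a, b)\<close> of a cover is cut into \<open>(min a c, min b c)\<close> and
  \<open>(max a c, max b c)\<close>, one of which is empty if \<open>c\<close> lies outside; the lengths add up to
  \<open>b - a\<close>.  The point \<open>c\<close> itself, lost by cutting, is a null set.
\<close>

lemma half_line_caratheodory: "{c<..} \<inter> S \<in> caratheodory_sets S"
proof (rule caratheodory_setsI)
  fix X assume X: "X \<subseteq> S"
  have split: "lebesgue_outer ({c<..} \<inter> X) + lebesgue_outer ({..<c} \<inter> X) \<le>
      (\<Sum>n. ennreal (b n - a n))" if cover: "interval_cover a b X" for a b
  proof -
    have le: "a n \<le> b n" for n using cover by (simp add: interval_cover_def)
    have "interval_cover (\<lambda>n. max (a n) c) (\<lambda>n. max (b n) c) ({c<..} \<inter> X)"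
      unfolding interval_cover_def
    proof (intro conjI allI subsetI)
      fix x assume x: "x \<in> {c<..} \<inter> X"
      then obtain n where "x \<in> {a n<..<b n}"
        using cover unfolding interval_cover_def by blast
      with x have "x \<in> {max (a n) c<..<max (b n) c}" by auto
      then show "x \<in> (\<Union>n. {max (a n) c<..<max (b n) c})" by blast
    qed (intro max.mono le order_refl)
    then have 1: "lebesgue_outer ({c<..} \<inter> X) \<le> (\<Sum>n. ennreal (max (b n) c - max (a n) c))"
      by (rule lebesgue_outer_le_cover)
    have "interval_cover (\<lambda>n. min (a n) c) (\<lambda>n. min (b n) c) ({..<c} \<inter> X)"
      unfolding interval_cover_def
    proof (intro conjI allI subsetI)
      fix x assume x: "x \<in> {..<c} \<inter> X"
      then obtain n where "x \<in> {a n<..<b n}"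
        using cover unfolding interval_cover_def by blast
      with x have "x \<in> {min (a n) c<..<min (b n) c}" by auto
      then show "x \<in> (\<Union>n. {min (a n) c<..<min (b n) c})" by blast
    qed (intro min.mono le order_refl)
    then have 2: "lebesgue_outer ({..<c} \<inter> X) \<le> (\<Sum>n. ennreal (min (b n) c - min (a n) c))"
      by (rule lebesgue_outer_le_cover)
    have "ennreal (max (b n) c - max (a n) c) + ennreal (min (b n) c - min (a n) c) =
        ennreal (b n - a n)" for n
      using le[of n] by (subst ennreal_plus[symmetric]) (auto simp: max_def min_def simp del: ennreal_plus)
    then have "(\<Sum>n. ennreal (max (b n) c - max (a n) c)) +
        (\<Sum>n. ennreal (min (b n) c - min (a n) c)) = (\<Sum>n. ennreal (b n - a n))"
      by (subst suminf_add) auto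
    with add_mono[OF 1 2] show ?thesis by simp
  qed
  have "lebesgue_outer (X - {c<..} \<inter> S) \<le> lebesgue_outer (({..<c} \<inter> X) \<union> {c})"
    using X by (intro lebesgue_outer_mono) auto
  also have "\<dots> \<le> lebesgue_outer ({..<c} \<inter> X)"
    using lebesgue_outer_Un_le[of "{..<c} \<inter> X" "{c}"] by (simp add: lebesgue_outer_singleton)
  finally have "lebesgue_outer ({c<..} \<inter> S \<inter> X) + lebesgue_outer (X - {c<..} \<inter> S) \<le>
      lebesgue_outer ({c<..} \<inter> X) + lebesgue_outer ({..<c} \<inter> X)"
    by (intro add_mono) (auto intro: lebesgue_outer_mono)
  also have "\<dots> \<le> lebesgue_outer X"
    unfolding lebesgue_outer_def[of X] using split by (intro INF_greatest) auto
  finally show "lebesgue_outer ({c<..} \<inter> S \<inter> X) + lebesgue_outer (X - {c<..} \<inter> S) \<le>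
      lebesgue_outer X" .
qed simp

text \<open>The sets whose trace on \<open>S\<close> lies in a \<open>\<sigma>\<close>-algebra on \<open>S\<close> form a \<open>\<sigma>\<close>-algebra.\<close>

lemma sigma_sets_trace:
  assumes "sigma_algebra S L" and "\<And>G. G \<in> \<G> \<Longrightarrow> G \<inter> S \<in> L" and "A \<in> sigma_sets UNIV \<G>"
  shows "A \<inter> S \<in> L"
proof -
  interpret sigma_algebra S L by fact
  show ?thesis using assms(3)
  proof induction
    case (Compl A)
    from Compl.IH have "S - A \<inter> S \<in> L" by (rule compl_sets)
    moreover have "(UNIV - A) \<inter> S = S - A \<inter> S" by auto
    ultimately show ?case by simp
  next
    case (Union A)
    then have "(\<Union>i. A i \<inter> S) \<in> L" by (intro countable_UN) auto
    then show ?case by (simp add: Int_UN_distrib2)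
  qed (use assms(2) in auto)
qed

lemma borel_caratheodory:
  assumes "A \<in> sets borel" "A \<subseteq> S"
  shows "A \<in> caratheodory_sets S"
proof -
  have "sets (borel :: real measure) = sigma_sets UNIV (range greaterThan)"
    by (subst borel_Ioi) (auto intro!: sets_measure_of)
  with assms(1) have A: "A \<in> sigma_sets UNIV (range greaterThan)" by simp
  have "G \<inter> S \<in> caratheodory_sets S" if "G \<in> range greaterThan" for G :: "real set"
    using that half_line_caratheodory by blast
  from sigma_algebra_caratheodory this A have "A \<inter> S \<in> caratheodory_sets S"
    by (rule sigma_sets_trace)
  with assms(2) show ?thesis by (simp add: Int_absorb2)
qed

section \<open>The condition of Caratheodory implies measurability\<close>

lemma sigma_algebra_measurable_sets: "sigma_algebra UNIV measurable_sets"
  unfolding measurable_sets_def by (intro sigma_algebra_sigma_sets) auto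

lemma null_set_measurable: "is_null_set N \<Longrightarrow> N \<in> measurable_sets"
  unfolding measurable_sets_def by (intro sigma_sets.Basic) auto

lemma borel_measurable_sets:
  assumes "A \<in> sets borel"
  shows "A \<in> measurable_sets"
proof -
  have "sets (borel :: real measure) = sigma_sets UNIV (range (\<lambda>(a, b). box a b))"
    by (subst borel_eq_box) (auto intro!: sets_measure_of)
  also have "\<dots> \<subseteq> measurable_sets"
    unfolding measurable_sets_def
  proof (intro sigma_sets_mono, clarify)
    fix a b :: real
    let ?G = "{{a<..<b} |a b :: real. a \<le> b} \<union> {N. is_null_set N}"
    show "box a b \<in> sigma_sets UNIV ?G"
      unfolding box_real by (cases "a \<le> b") (auto intro: sigma_sets.Empty)
  qed
  finally show ?thesis using assms by auto
qed

text \<open>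
  Intersect a sequence of covers whose total lengths tend to the infimum; each of them still
  covers the intersection.
\<close>

lemma borel_hull:
  obtains B where "B \<in> sets borel" "A \<subseteq> B" "lebesgue_outer B = lebesgue_outer A"
proof -
  let ?L = "(\<lambda>(a, b). \<Sum>n. ennreal (b n - a n)) ` {(a, b). interval_cover a b A}"
  have "interval_cover (\<lambda>n. - real n) real A"
    unfolding interval_cover_def
  proof (intro conjI allI subsetI)
    fix x
    obtain n :: nat where "\<bar>x\<bar> < real n" using reals_Archimedean2 by blast
    then show "x \<in> (\<Union>n. {- real n<..<real n})" by (auto intro!: exI[of _ n])
  qed simp
  then have "?L \<noteq> {}" by auto
  then obtain f where f: "range f \<subseteq> ?L" "lebesgue_outer A = (INF i :: nat. f i)"
    unfolding lebesgue_outer_def using ennreal_Inf_countable_INF[of ?L] by auto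
  have "\<exists>a b. interval_cover a b A \<and> f i = (\<Sum>n. ennreal (b n - a n))" for i
    using f(1) by fastforce
  then obtain a b where cover: "\<And>i. interval_cover (a i) (b i) A"
    and len: "\<And>i. f i = (\<Sum>n. ennreal (b i n - a i n))"
    by metis
  define B where "B = (\<Inter>i. \<Union>n. {a i n<..<b i n})"
  have borel: "B \<in> sets borel" unfolding B_def by (intro sets.countable_INT) auto
  have sub: "A \<subseteq> B" unfolding B_def using cover by (auto simp: interval_cover_def)
  have "interval_cover (a i) (b i) B" for i
    using cover[of i] by (auto simp: B_def interval_cover_def)
  then have "lebesgue_outer B \<le> lebesgue_outer A"
    unfolding f(2) len by (intro INF_greatest lebesgue_outer_le_cover)
  with borel sub lebesgue_outer_mono[OF sub] show thesis by (intro that) auto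
qed

lemma caratheodory_subset_measurable:
  assumes S: "S \<in> sets borel" "lebesgue_outer S < \<infinity>" and A: "A \<in> caratheodory_sets S"
  shows "A \<in> measurable_sets"
proof -
  interpret sigma_algebra UNIV measurable_sets by (rule sigma_algebra_measurable_sets)
  from A have "A \<subseteq> S" by (simp add: caratheodory_sets_iff)
  obtain B where B: "B \<in> sets borel" "A \<subseteq> B" "lebesgue_outer B = lebesgue_outer A"
    by (rule borel_hull)
  have "A \<inter> (B \<inter> S) = A" "(S - A) \<inter> (B \<inter> S) = B \<inter> S - A"
    using B(2) \<open>A \<subseteq> S\<close> by auto
  then have "lebesgue_outer A + lebesgue_outer (B \<inter> S - A) = lebesgue_outer (B \<inter> S)"
    using A unfolding caratheodory_sets_iff by (metis Int_lower2)
  also have "\<dots> \<le> lebesgue_outer A"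
    unfolding B(3)[symmetric] by (intro lebesgue_outer_mono) auto
  finally have "lebesgue_outer A + lebesgue_outer (B \<inter> S - A) \<le> lebesgue_outer A + 0"
    by simp
  moreover have "lebesgue_outer A < \<infinity>"
    using lebesgue_outer_mono[OF \<open>A \<subseteq> S\<close>] S(2) by simp
  ultimately have "lebesgue_outer (B \<inter> S - A) = 0"
    by (subst (asm) ennreal_add_left_cancel_le) auto
  then have "B \<inter> S - A \<in> measurable_sets"
    by (intro null_set_measurable) (simp add: is_null_set_iff)
  moreover have "B \<inter> S \<in> measurable_sets"
    using B(1) S(1) by (intro borel_measurable_sets) auto
  ultimately have "B \<inter> S - (B \<inter> S - A) \<in> measurable_sets" by (rule Diff[rotated])
  moreover have "B \<inter> S - (B \<inter> S - A) = A" using B(2) \<open>A \<subseteq> S\<close> by auto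
  ultimately show ?thesis by simp
qed

section \<open>Equality of the \<open>\<sigma>\<close>-algebras\<close>

text \<open>
  The trace argument applies because the Borel sets and the null sets are each stable under
  intersection with the Borel set \<open>S\<close>.
\<close>

lemma measurable_subsets_generated:
  assumes S: "S \<in> sets borel"
  shows "measurable_subsets S \<subseteq>
    sigma_sets S {A. A \<subseteq> S \<and> (A \<in> sets borel \<or> is_null_set A)}" (is "_ \<subseteq> sigma_sets S ?G")
proof
  fix A assume "A \<in> measurable_subsets S"
  then have A: "A \<subseteq> S" "A \<in> measurable_sets" by (auto simp: measurable_subsets_def)
  have "is_null_set (N \<inter> S)" if "is_null_set N" for N
    using that lebesgue_outer_mono[of "N \<inter> S" N] by (simp add: is_null_set_iff)
  then have generators: "G \<inter> S \<in> sigma_sets S ?G"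
    if "G \<in> {{a<..<b} |a b. a \<le> b} \<union> {N. is_null_set N}" for G
    using that S by (intro sigma_sets.Basic) auto
  have "sigma_algebra S (sigma_sets S ?G)"
    by (intro sigma_algebra_sigma_sets) auto
  then have "A \<inter> S \<in> sigma_sets S ?G"
    using generators A(2)[unfolded measurable_sets_def] by (rule sigma_sets_trace)
  with A(1) show "A \<in> sigma_sets S ?G" by (simp add: Int_absorb2)
qed

lemma generated_subset_caratheodory:
  "sigma_sets S {A. A \<subseteq> S \<and> (A \<in> sets borel \<or> is_null_set A)} \<subseteq> caratheodory_sets S"
  by (rule sigma_algebra.sigma_sets_subset[OF sigma_algebra_caratheodory])
    (blast intro: borel_caratheodory null_set_caratheodory)

theorem corollaryA3p9:
  shows "sigma_algebra {0..1::real} (caratheodory_sets {0..1}) \<and>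
    caratheodory_sets {0..1} = measurable_subsets {0..1} \<and>
    measurable_subsets {0..1} =
      sigma_sets {0..1} {A. A \<subseteq> {0..1} \<and> (A \<in> sets borel \<or> is_null_set A)}"
proof -
  have "lebesgue_outer {0..1} \<le> ennreal (2 - (- 1))"
    by (rule lebesgue_outer_le_length) auto
  then have fin: "lebesgue_outer {0..1} < \<infinity>"
    by (rule order.strict_trans1) simp
  have borel: "{0..1::real} \<in> sets borel" by simp
  have sub: "caratheodory_sets {0..1} \<subseteq> measurable_subsets {0..1}"
  proof
    fix A :: "real set" assume A: "A \<in> caratheodory_sets {0..1}"
    then have "A \<subseteq> {0..1}" by (rule caratheodory_sets_iff[THEN iffD1, THEN conjunct1])
    then show "A \<in> measurable_subsets {0..1}"
      using caratheodory_subset_measurable[OF borel fin A]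
      unfolding measurable_subsets_def by (intro CollectI conjI)
  qed
  note gen = measurable_subsets_generated[OF borel]
  note car = generated_subset_caratheodory[of "{0..1}"]
  have "caratheodory_sets {0..1} = measurable_subsets {0..1}"
    using sub order_trans[OF gen car] by (rule subset_antisym)
  moreover have "measurable_subsets {0..1} =
      sigma_sets {0..1} {A. A \<subseteq> {0..1} \<and> (A \<in> sets borel \<or> is_null_set A)}"
    using gen order_trans[OF car sub] by (rule subset_antisym)
  ultimately show ?thesis by (intro conjI sigma_algebra_caratheodory)
qed

end
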